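(* Let $a,b,p,q$ be integers with $p^2+4q\neq 0$, let $(w_n)_{n\ge 0}$ be the Horadam sequence $w_0=a$, $w_1=b$, $w_n=pw_{n-1}+qw_{n-2}$ for $n\ge 2$, and let $\mathbb{O}G_n=w_ne_0+w_{n+1}e_1+\dots+w_{n+7}e_7$ be the $n$-th Horadam octonion. Put $\alpha=\frac{p+\sqrt{p^2+4q}}{2}$, $\beta=\frac{p-\sqrt{p^2+4q}}{2}$, $A=b-a\beta$, $B=b-a\alpha$, $\underline{\alpha}=1e_0+\alpha e_1+\alpha^2e_2+\dots+\alpha^7e_7$ and $\underline{\beta}=1e_0+\beta e_1+\beta^2e_2+\dots+\beta^7e_7$. Then for every integer $n\ge 1$: (i) $$\mathbb{O}G_{n-1}\circ\mathbb{O}G_{n+1}-\mathbb{O}G_n^2=\frac{AB(\alpha\beta)^{n-1}\left(\beta\,\underline{\alpha}\,\underline{\beta}-\alpha\,\underline{\beta}\,\underline{\alpha}\right)}{\alpha-\beta};$$ (ii) $$\mathbb{O}G_{n+1}\circ\mathbb{O}G_{n-1}-\mathbb{O}G_n^2=\frac{AB(\alpha\beta)^{n-1}\left(\beta\,\underline{\beta}\,\underline{\alpha}-\alpha\,\underline{\alpha}\,\underline{\beta}\right)}{\alpha-\beta}.$$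
   Context: $\mathbb{O}$ is the eight-dimensional real octonion algebra (non-commutative, non-associative) with standard basis $e_0=1,e_1,\dots,e_7$. The product is denoted by $\circ$ or juxtaposition and $x^2=x\circ x$. It is the standard octonion product, obtained e.g. by the Cayley–Dickson process from the quaternions $\mathbb{H}$: $\mathbb{O}=\mathbb{H}\oplus\mathbb{H}$ with $(x,y)(z,w)=(xz-\overline{w}y,\;wx+y\overline{z})$, where $e_0,e_1,e_2,e_3$ are $(1,0),(i,0),(j,0),(k,0)$ and $e_4,e_5,e_6,e_7$ are $(0,1),(0,i),(0,j),(0,k)$. If $p^2+4q<0$, then $\sqrt{p^2+4q}$ denotes a fixed complex square root, and the identities are understood in the complexification $\mathbb{O}\otimes_{\mathbb{R}}\mathbb{C}$ with the $\mathbb{C}$-bilinearly extended product. The convention $0^0=1$ is used. *)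

theory Defs
  imports Complex_Main
begin

text \<open>Quaternions and octonions are built over an arbitrary commutative coefficient ring:
  \<open>real octonion\<close> is the algebra \<open>\<bbbO>\<close>, and \<open>complex octonion\<close> is its complexification, i.e. the
  algebra on the same basis with the same structure constants and complex coefficients
  (see \<open>complexify_mult\<close> and \<open>complex_octonion_decomp\<close> together with the bilinearity lemmas).\<close>

datatype 'a quat = Quat (qre: 'a) (qi: 'a) (qj: 'a) (qk: 'a)

instantiation quat :: (comm_ring_1) ring_1
begin

definition "0 = Quat 0 0 0 0"
definition "1 = Quat 1 0 0 0"
definition "x + y = Quat (qre x + qre y) (qi x + qi y) (qj x + qj y) (qk x + qk y)"
definition "x - y = Quat (qre x - qre y) (qi x - qi y) (qj x - qj y) (qk x - qk y)"
definition "- x = Quat (- qre x) (- qi x) (- qj x) (- qk x)"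
definition "x * y = Quat
  (qre x * qre y - qi x * qi y - qj x * qj y - qk x * qk y)
  (qre x * qi y + qi x * qre y + qj x * qk y - qk x * qj y)
  (qre x * qj y - qi x * qk y + qj x * qre y + qk x * qi y)
  (qre x * qk y + qi x * qj y - qj x * qi y + qk x * qre y)"

lemmas quat_defs = zero_quat_def one_quat_def plus_quat_def minus_quat_def
  uminus_quat_def times_quat_def

instance
  by standard (simp_all add: quat_defs algebra_simps)

end

text \<open>Quaternion conjugation. It is linear over the coefficient ring; for complex coefficients
  it does \<^emph>\<open>not\<close> conjugate the coefficients, as required for the bilinear extension.\<close>

definition qcnj :: "'a::comm_ring_1 quat \<Rightarrow> 'a quat" where
  "qcnj x = Quat (qre x) (- qi x) (- qj x) (- qk x)"

definition quat_scale :: "'a::comm_ring_1 \<Rightarrow> 'a quat \<Rightarrow> 'a quat" where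
  "quat_scale c x = Quat (c * qre x) (c * qi x) (c * qj x) (c * qk x)"

definition quat_basis :: "nat \<Rightarrow> 'a::comm_ring_1 quat" where
  "quat_basis k = Quat (of_bool (k = 0)) (of_bool (k = 1)) (of_bool (k = 2)) (of_bool (k = 3))"

datatype 'a octonion = Octonion (ofst: "'a quat") (osnd: "'a quat")

instantiation octonion :: (comm_ring_1) "{ab_group_add, times}"
begin

definition "0 = Octonion 0 0"
definition "x + y = Octonion (ofst x + ofst y) (osnd x + osnd y)"
definition "x - y = Octonion (ofst x - ofst y) (osnd x - osnd y)"
definition "- x = Octonion (- ofst x) (- osnd x)"
definition "x * y = Octonion
  (ofst x * ofst y - qcnj (osnd y) * osnd x)
  (osnd y * ofst x + osnd x * qcnj (ofst y))"

lemmas octonion_defs = zero_octonion_def plus_octonion_def minus_octonion_def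
  uminus_octonion_def times_octonion_def

instance
  by standard (simp_all add: octonion_defs)

end

definition oct_scale :: "'a::comm_ring_1 \<Rightarrow> 'a octonion \<Rightarrow> 'a octonion"  (infixr "*\<^sub>O" 75) where
  "c *\<^sub>O x = Octonion (quat_scale c (ofst x)) (quat_scale c (osnd x))"

text \<open>The standard basis, meaningful for \<open>k < 8\<close>.\<close>

definition oct_basis :: "nat \<Rightarrow> 'a::comm_ring_1 octonion" where
  "oct_basis k = (if k < 4 then Octonion (quat_basis k) 0 else Octonion 0 (quat_basis (k - 4)))"

definition complexify :: "real octonion \<Rightarrow> complex octonion" where
  "complexify = map_octonion complex_of_real"

fun horadam :: "int \<Rightarrow> int \<Rightarrow> int \<Rightarrow> int \<Rightarrow> nat \<Rightarrow> int" where
  "horadam a b p q 0 = a"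
| "horadam a b p q (Suc 0) = b"
| "horadam a b p q (Suc (Suc n)) = p * horadam a b p q (Suc n) + q * horadam a b p q n"

definition horadam_octonion :: "int \<Rightarrow> int \<Rightarrow> int \<Rightarrow> int \<Rightarrow> nat \<Rightarrow> real octonion" where
  "horadam_octonion a b p q n = (\<Sum>k\<le>7. real_of_int (horadam a b p q (n + k)) *\<^sub>O oct_basis k)"

text \<open>The octonion written as an underlined \<open>x\<close>.\<close>

definition power_octonion :: "'a::comm_ring_1 \<Rightarrow> 'a octonion" where
  "power_octonion x = (\<Sum>k\<le>7. x ^ k *\<^sub>O oct_basis k)"

lemmas octonion_all_defs = octonion_defs oct_scale_def quat_defs qcnj_def quat_scale_def

lemma octonion_distrib_right: "(x + y) * z = x * z + y * (z :: 'a::comm_ring_1 octonion)"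
  and octonion_distrib_left: "z * (x + y) = z * x + z * y"
  and oct_scale_mult_left: "(c *\<^sub>O x) * y = c *\<^sub>O (x * y)"
  and oct_scale_mult_right: "x * (c *\<^sub>O y) = c *\<^sub>O (x * y)"
  by (simp_all add: octonion_all_defs algebra_simps)

lemma oct_basis_0_left: "oct_basis 0 * x = x"
  and oct_basis_0_right: "x * oct_basis 0 = x"
  by (simp_all add: octonion_all_defs oct_basis_def quat_basis_def)

lemma oct_basis_products:
  "oct_basis 1 * oct_basis 2 = oct_basis 3"
  "oct_basis 2 * oct_basis 1 = - oct_basis 3"
  "oct_basis 1 * oct_basis 4 = oct_basis 5"
  "oct_basis 2 * oct_basis 4 = oct_basis 6"
  "oct_basis 3 * oct_basis 4 = oct_basis 7"
  by (simp_all add: octonion_all_defs oct_basis_def quat_basis_def)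

lemma complexify_mult: "complexify (x * y) = complexify x * complexify y"
  by (cases x; cases y; cases "ofst x"; cases "osnd x"; cases "ofst y"; cases "osnd y")
    (simp add: complexify_def octonion_all_defs)

lemma complexify_add: "complexify (x + y) = complexify x + complexify y"
  by (cases x; cases y; cases "ofst x"; cases "osnd x"; cases "ofst y"; cases "osnd y")
    (simp add: complexify_def octonion_all_defs)

lemma complex_octonion_decomp: "\<exists>!(x, y). z = complexify x + \<i> *\<^sub>O complexify y"
proof -
  define r where "r = (map_octonion Re z, map_octonion Im z)"
  have 1: "z = complexify (fst r) + \<i> *\<^sub>O complexify (snd r)"
    by (cases z; cases "ofst z"; cases "osnd z")
      (simp add: r_def complexify_def octonion_all_defs complex_eq_iff)
  have 2: "(x, y) = r" if "z = complexify x + \<i> *\<^sub>O complexify y" for x y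
    using that
    by (cases x; cases y; cases "ofst x"; cases "osnd x"; cases "ofst y"; cases "osnd y")
      (simp add: r_def complexify_def octonion_all_defs)
  show ?thesis
  proof (rule ex1I[of _ r])
    show "case r of (x, y) \<Rightarrow> z = complexify x + \<i> *\<^sub>O complexify y"
      using 1 by (simp only: split_beta)
  next
    fix t
    assume "case t of (x, y) \<Rightarrow> z = complexify x + \<i> *\<^sub>O complexify y"
    then show "t = r"
      using 2[of "fst t" "snd t"] by (simp only: split_beta prod.collapse)
  qed
qed

end

theory Submission
  imports Defs
begin

text \<open>By Binet's formula every Horadam octonion is a combination
  \<open>(A \<alpha>\<^sup>n / (\<alpha> - \<beta>)) u - (B \<beta>\<^sup>n / (\<alpha> - \<beta>)) v\<close> of the power octonions \<open>u\<close> of \<open>\<alpha>\<close> and \<open>v\<close> of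
  \<open>\<beta>\<close>. In \<open>G (n - 1) * G (n + 1) - G n * G n\<close> the terms in \<open>u u\<close> and \<open>v v\<close> cancel, so only
  bilinearity of the product is needed, neither associativity nor alternativity.\<close>

lemma oct_scale_left_diff: "(c - d) *\<^sub>O x = c *\<^sub>O x - d *\<^sub>O x"
  and oct_scale_right_diff: "c *\<^sub>O (x - y) = c *\<^sub>O x - c *\<^sub>O y"
  and oct_scale_right_add: "c *\<^sub>O (x + y) = c *\<^sub>O x + c *\<^sub>O y"
  and oct_scale_scale: "c *\<^sub>O (d *\<^sub>O x) = (c * d) *\<^sub>O x"
  and oct_scale_zero_right: "c *\<^sub>O 0 = 0"
  by (simp_all add: octonion_all_defs algebra_simps)

lemma octonion_diff_distrib_right: "(x - y) * z = x * z - y * (z :: 'a::comm_ring_1 octonion)"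
  and octonion_diff_distrib_left: "z * (x - y) = z * x - z * y"
  by (simp_all add: octonion_all_defs algebra_simps)

lemma oct_scale_sum: "c *\<^sub>O (\<Sum>k\<in>S. f k) = (\<Sum>k\<in>S. c *\<^sub>O f k)"
  by (induction S rule: infinite_finite_induct)
    (simp_all add: oct_scale_zero_right oct_scale_right_add)

text \<open>Expanding bilinearly, the hypotheses equate the coefficients of \<open>u * u\<close> and
  of \<open>v * v\<close> in the two products, leaving only mixed terms. Since \<open>u\<close> and
  \<open>v\<close> need not commute, \<open>u * v\<close> and \<open>v * u\<close> stay separate.
  Exchanging the indices 1 and 2 gives the version with the outer factors reversed.\<close>

lemma octonion_cassini_difference:
  fixes u v :: "'a::comm_ring_1 octonion"
  assumes "x1 * x2 = x * x" and "y1 * y2 = y * y"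
  shows "(x1 *\<^sub>O u - y1 *\<^sub>O v) * (x2 *\<^sub>O u - y2 *\<^sub>O v) - (x *\<^sub>O u - y *\<^sub>O v) * (x *\<^sub>O u - y *\<^sub>O v)
    = (x * y - x1 * y2) *\<^sub>O (u * v) - (x2 * y1 - x * y) *\<^sub>O (v * u)"
proof -
  have "(x2 *\<^sub>O (x1 *\<^sub>O (u * u))) = x *\<^sub>O (x *\<^sub>O (u * u))"
    and "(y2 *\<^sub>O (y1 *\<^sub>O (v * v))) = y *\<^sub>O (y *\<^sub>O (v * v))"
    using assms by (simp_all add: oct_scale_scale mult.commute)
  then show ?thesis
    by (simp add: oct_scale_mult_left oct_scale_mult_right octonion_diff_distrib_left
        octonion_diff_distrib_right oct_scale_left_diff oct_scale_right_diff oct_scale_scale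
        algebra_simps)
qed

text \<open>Describing the roots by their sum and product avoids square roots and lets one statement
  serve both the real and the complex case.\<close>

lemma horadam_binet:
  fixes \<alpha> \<beta> :: "'a::field"
  assumes "\<alpha> \<noteq> \<beta>" and sum: "\<alpha> + \<beta> = of_int p" and prod: "\<alpha> * \<beta> = - of_int q"
  shows "of_int (horadam a b p q n)
    = ((of_int b - of_int a * \<beta>) * \<alpha> ^ n - (of_int b - of_int a * \<alpha>) * \<beta> ^ n) / (\<alpha> - \<beta>)"
proof -
  define A B where "A = of_int b - of_int a * \<beta>" and "B = of_int b - of_int a * \<alpha>"
  \<comment> \<open>Clearing the denominator first keeps the induction purely polynomial.\<close>
  have "(\<alpha> - \<beta>) * of_int (horadam a b p q n) = A * \<alpha> ^ n - B * \<beta> ^ n"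
  proof (induction n rule: induct_nat_012)
    case (ge2 n)
    \<comment> \<open>The recurrence, with \<open>p\<close> replaced by \<alpha> + \<beta> and
      \<open>q\<close> by -\<alpha>\<beta>.\<close>
    have "(\<alpha> - \<beta>) * of_int (horadam a b p q (Suc (Suc n)))
      = (\<alpha> + \<beta>) * ((\<alpha> - \<beta>) * of_int (horadam a b p q (Suc n)))
        - \<alpha> * \<beta> * ((\<alpha> - \<beta>) * of_int (horadam a b p q n))"
      by (simp add: sum prod algebra_simps)
    also have "\<dots> = A * \<alpha> ^ Suc (Suc n) - B * \<beta> ^ Suc (Suc n)"
      unfolding ge2 by (simp add: algebra_simps)
    finally show ?case .
  qed (simp_all add: A_def B_def algebra_simps)
  then show ?thesis
    using assms(1) by (simp add: A_def B_def eq_divide_eq mult.commute)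
qed

text \<open>The coordinates are integers, so they can be cast into any coefficient ring. The Cassini
  argument can thus be given once over a field and then used for both real and complex
  octonions.\<close>

definition horadam_octonion_over :: "int \<Rightarrow> int \<Rightarrow> int \<Rightarrow> int \<Rightarrow> nat \<Rightarrow> 'a::comm_ring_1 octonion" where
  "horadam_octonion_over a b p q n = (\<Sum>k\<le>7. of_int (horadam a b p q (n + k)) *\<^sub>O oct_basis k)"

lemma complexify_sum: "complexify (\<Sum>k\<in>S. f k) = (\<Sum>k\<in>S. complexify (f k))"
proof -
  have "complexify 0 = 0"
    by (simp add: complexify_def octonion_all_defs)
  then show ?thesis
    by (induction S rule: infinite_finite_induct) (simp_all add: complexify_add)
qed

lemma complexify_horadam_octonion:
  "complexify (horadam_octonion a b p q n) = horadam_octonion_over a b p q n"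
proof -
  have "complexify (c *\<^sub>O oct_basis k) = complex_of_real c *\<^sub>O oct_basis k" for c k
    by (simp add: complexify_def oct_basis_def quat_basis_def octonion_all_defs)
  then show ?thesis
    by (simp add: horadam_octonion_def horadam_octonion_over_def complexify_sum)
qed

text \<open>Binet's formula is applied to each coordinate \<open>n + k\<close>; splitting
  \<open>\<alpha> ^ (n + k)\<close> as \<open>\<alpha> ^ n * \<alpha> ^ k\<close> separates the
  scalar from the power octonion, and likewise for \<beta>.\<close>

lemma horadam_octonion_binet:
  fixes \<alpha> \<beta> :: "'a::field"
  assumes "\<alpha> \<noteq> \<beta>" and "\<alpha> + \<beta> = of_int p" and "\<alpha> * \<beta> = - of_int q"
  shows "horadam_octonion_over a b p q n
    = ((of_int b - of_int a * \<beta>) * \<alpha> ^ n / (\<alpha> - \<beta>)) *\<^sub>O power_octonion \<alpha>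
      - ((of_int b - of_int a * \<alpha>) * \<beta> ^ n / (\<alpha> - \<beta>)) *\<^sub>O power_octonion \<beta>"
  unfolding horadam_octonion_over_def power_octonion_def oct_scale_sum sum_subtractf[symmetric]
    oct_scale_scale oct_scale_left_diff[symmetric] horadam_binet[OF assms]
  by (simp add: power_add diff_divide_distrib mult.assoc)

lemma horadam_octonion_cassini:
  fixes \<alpha> \<beta> :: "'a::field" and a b p q :: int
  assumes neq: "\<alpha> \<noteq> \<beta>" and "\<alpha> + \<beta> = of_int p" and "\<alpha> * \<beta> = - of_int q" and "n \<ge> 1"
  defines "A \<equiv> of_int b - of_int a * \<beta>" and "B \<equiv> of_int b - of_int a * \<alpha>"
    and "u \<equiv> power_octonion \<alpha>" and "v \<equiv> power_octonion \<beta>"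
    and "G \<equiv> horadam_octonion_over a b p q"
  shows "G (n - 1) * G (n + 1) - G n * G n
      = (A * B * (\<alpha> * \<beta>) ^ (n - 1) / (\<alpha> - \<beta>)) *\<^sub>O (\<beta> *\<^sub>O (u * v) - \<alpha> *\<^sub>O (v * u))"
    and "G (n + 1) * G (n - 1) - G n * G n
      = (A * B * (\<alpha> * \<beta>) ^ (n - 1) / (\<alpha> - \<beta>)) *\<^sub>O (\<beta> *\<^sub>O (v * u) - \<alpha> *\<^sub>O (u * v))"
proof -
  \<comment> \<open>This turns the truncated subtraction \<open>n - 1\<close> into the genuine
    predecessor \<open>m\<close>.\<close>
  obtain m where n: "n = Suc m"
    using \<open>n \<ge> 1\<close> by (cases n) auto
  define x y where "x k = A * \<alpha> ^ k / (\<alpha> - \<beta>)" and "y k = B * \<beta> ^ k / (\<alpha> - \<beta>)" for k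
  define c where "c = A * B * (\<alpha> * \<beta>) ^ m / (\<alpha> - \<beta>)"
  have G: "G k = x k *\<^sub>O u - y k *\<^sub>O v" for k
    unfolding assms x_def y_def using assms(1-3) by (rule horadam_octonion_binet)
  \<comment> \<open>Both \<open>x\<close> and \<open>y\<close> are geometric sequences, so a middle
    term squared is the product of its neighbours.\<close>
  have sq: "x m * x (n + 1) = x n * x n" "y m * y (n + 1) = y n * y n"
    by (simp_all add: x_def y_def n)
  have coeff: "x n * y n - x m * y (n + 1) = c * \<beta>" "x (n + 1) * y m - x n * y n = c * \<alpha>"
  proof -
    have d: "\<alpha> - \<beta> \<noteq> 0"
      using neq by simp
    \<comment> \<open>The factorizations are \<alpha>\<beta> - \<beta>^2 = \<beta>(\<alpha> -
      \<beta>) and \<alpha>^2 - \<alpha>\<beta> = \<alpha>(\<alpha> - \<beta>). The factor \<alpha>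
      - \<beta> then cancels one of the two denominators coming from \<open>x\<close> and
      \<open>y\<close>.\<close>
    have "x n * y n - x m * y (n + 1) = c * \<beta> * (\<alpha> - \<beta>) / (\<alpha> - \<beta>)"
      and "x (n + 1) * y m - x n * y n = c * \<alpha> * (\<alpha> - \<beta>) / (\<alpha> - \<beta>)"
      by (simp_all add: x_def y_def c_def n power_mult_distrib add_divide_distrib
          diff_divide_distrib algebra_simps)
    with d show "x n * y n - x m * y (n + 1) = c * \<beta>" "x (n + 1) * y m - x n * y n = c * \<alpha>"
      by simp_all
  qed
  show "G (n - 1) * G (n + 1) - G n * G n
      = (A * B * (\<alpha> * \<beta>) ^ (n - 1) / (\<alpha> - \<beta>)) *\<^sub>O (\<beta> *\<^sub>O (u * v) - \<alpha> *\<^sub>O (v * u))"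
    using octonion_cassini_difference[OF sq, of u v] coeff
    by (simp add: G n c_def oct_scale_right_diff oct_scale_scale)
  \<comment> \<open>For the reversed product \<open>m\<close> and \<open>n + 1\<close> trade places:
    the same two coefficients recur with opposite signs, now attached to the other mixed
    product.\<close>
  have sq': "x (n + 1) * x m = x n * x n" "y (n + 1) * y m = y n * y n"
    using sq by (simp_all add: mult.commute)
  have coeff': "x n * y n - x (n + 1) * y m = - (c * \<alpha>)" "x m * y (n + 1) - x n * y n = - (c * \<beta>)"
    using coeff by (simp_all flip: coeff)
  have minus: "(- r) *\<^sub>O z = - (r *\<^sub>O z)" for r :: 'a and z
    by (simp add: octonion_all_defs)
  show "G (n + 1) * G (n - 1) - G n * G n
      = (A * B * (\<alpha> * \<beta>) ^ (n - 1) / (\<alpha> - \<beta>)) *\<^sub>O (\<beta> *\<^sub>O (v * u) - \<alpha> *\<^sub>O (u * v))"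
    using octonion_cassini_difference[OF sq', of u v] coeff'
    by (simp add: G n c_def minus oct_scale_right_diff oct_scale_scale)
qed

theorem theorem3p3:
  fixes a b p q :: int and n :: nat
  assumes "p\<^sup>2 + 4 * q \<noteq> 0" and "n \<ge> 1"
  shows "(p\<^sup>2 + 4 * q > 0 \<longrightarrow>
    (let s = sqrt (real_of_int (p\<^sup>2 + 4 * q));
         \<alpha> = (real_of_int p + s) / 2;
         \<beta> = (real_of_int p - s) / 2;
         A = real_of_int b - real_of_int a * \<beta>;
         B = real_of_int b - real_of_int a * \<alpha>;
         u = power_octonion \<alpha>;
         v = power_octonion \<beta>;
         G = horadam_octonion a b p q
     in G (n - 1) * G (n + 1) - G n * G n
          = (A * B * (\<alpha> * \<beta>) ^ (n - 1) / (\<alpha> - \<beta>)) *\<^sub>O (\<beta> *\<^sub>O (u * v) - \<alpha> *\<^sub>O (v * u))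
      \<and> G (n + 1) * G (n - 1) - G n * G n
          = (A * B * (\<alpha> * \<beta>) ^ (n - 1) / (\<alpha> - \<beta>)) *\<^sub>O (\<beta> *\<^sub>O (v * u) - \<alpha> *\<^sub>O (u * v))))
  \<and> (p\<^sup>2 + 4 * q < 0 \<longrightarrow>
    (\<forall>s :: complex. s\<^sup>2 = of_int (p\<^sup>2 + 4 * q) \<longrightarrow>
    (let \<alpha> = (of_int p + s) / 2;
         \<beta> = (of_int p - s) / 2;
         A = of_int b - of_int a * \<beta>;
         B = of_int b - of_int a * \<alpha>;
         u = power_octonion \<alpha>;
         v = power_octonion \<beta>;
         G = (\<lambda>m. complexify (horadam_octonion a b p q m))
     in G (n - 1) * G (n + 1) - G n * G n
          = (A * B * (\<alpha> * \<beta>) ^ (n - 1) / (\<alpha> - \<beta>)) *\<^sub>O (\<beta> *\<^sub>O (u * v) - \<alpha> *\<^sub>O (v * u))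
      \<and> G (n + 1) * G (n - 1) - G n * G n
          = (A * B * (\<alpha> * \<beta>) ^ (n - 1) / (\<alpha> - \<beta>)) *\<^sub>O (\<beta> *\<^sub>O (v * u) - \<alpha> *\<^sub>O (u * v)))))"
proof (intro conjI impI allI)
  let ?D = "p\<^sup>2 + 4 * q"
  assume "?D > 0"
  define s where "s = sqrt (real_of_int ?D)"
  have s: "s \<noteq> 0" "s * s = of_int p * of_int p + 4 * of_int q"
    using \<open>?D > 0\<close> by (simp_all add: s_def power2_eq_square flip: of_int_mult of_int_add)
  have H: "horadam_octonion a b p q = horadam_octonion_over a b p q"
    by (simp add: fun_eq_iff horadam_octonion_def horadam_octonion_over_def)
  \<comment> \<open>The roots differ by \<open>s\<close>, which is nonzero, and their product is
    (p^2 - s^2)/4 = -q.\<close>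
  have roots: "(real_of_int p + s) / 2 \<noteq> (real_of_int p - s) / 2"
    "(real_of_int p + s) / 2 + (real_of_int p - s) / 2 = of_int p"
    "(real_of_int p + s) / 2 * ((real_of_int p - s) / 2) = - of_int q"
    using s by (auto simp: field_simps)
  show "let s = sqrt (real_of_int ?D);
         \<alpha> = (real_of_int p + s) / 2;
         \<beta> = (real_of_int p - s) / 2;
         A = real_of_int b - real_of_int a * \<beta>;
         B = real_of_int b - real_of_int a * \<alpha>;
         u = power_octonion \<alpha>;
         v = power_octonion \<beta>;
         G = horadam_octonion a b p q
     in G (n - 1) * G (n + 1) - G n * G n
          = (A * B * (\<alpha> * \<beta>) ^ (n - 1) / (\<alpha> - \<beta>)) *\<^sub>O (\<beta> *\<^sub>O (u * v) - \<alpha> *\<^sub>O (v * u))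
      \<and> G (n + 1) * G (n - 1) - G n * G n
          = (A * B * (\<alpha> * \<beta>) ^ (n - 1) / (\<alpha> - \<beta>)) *\<^sub>O (\<beta> *\<^sub>O (v * u) - \<alpha> *\<^sub>O (u * v))"
    unfolding Let_def H s_def[symmetric]
    by (intro conjI horadam_octonion_cassini roots assms(2))
next
  fix s :: complex
  let ?D = "p\<^sup>2 + 4 * q"
  assume D: "?D < 0" and s2: "s\<^sup>2 = of_int ?D"
  have "s \<noteq> 0"
    using assms(1) s2 by (metis of_int_eq_0_iff zero_power2)
  moreover have "s * s = of_int p * of_int p + 4 * of_int q"
    using s2 by (simp add: power2_eq_square)
  \<comment> \<open>The same computation from the square of \<open>s\<close> alone, so it covers
    either choice of complex root.\<close>
  ultimately have roots: "(of_int p + s) / 2 \<noteq> (of_int p - s) / 2"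
    "(of_int p + s) / 2 + (of_int p - s) / 2 = of_int p"
    "(of_int p + s) / 2 * ((of_int p - s) / 2) = - of_int q"
    by (auto simp: field_simps)
  show "let \<alpha> = (of_int p + s) / 2;
         \<beta> = (of_int p - s) / 2;
         A = of_int b - of_int a * \<beta>;
         B = of_int b - of_int a * \<alpha>;
         u = power_octonion \<alpha>;
         v = power_octonion \<beta>;
         G = (\<lambda>m. complexify (horadam_octonion a b p q m))
     in G (n - 1) * G (n + 1) - G n * G n
          = (A * B * (\<alpha> * \<beta>) ^ (n - 1) / (\<alpha> - \<beta>)) *\<^sub>O (\<beta> *\<^sub>O (u * v) - \<alpha> *\<^sub>O (v * u))
      \<and> G (n + 1) * G (n - 1) - G n * G n
          = (A * B * (\<alpha> * \<beta>) ^ (n - 1) / (\<alpha> - \<beta>)) *\<^sub>O (\<beta> *\<^sub>O (v * u) - \<alpha> *\<^sub>O (u * v))"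
    unfolding Let_def complexify_horadam_octonion
    by (intro conjI horadam_octonion_cassini roots assms(2))
qed

end
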